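(* Let $n\ge 1$ be an integer, let $s\in\mathbb{R}$, and let $A_0,A_1,\ldots,A_n\subset\mathbb{R}$ be closed sets such that (i) $A_0=\{0\}$ and $A_n=\{s\}$; and (ii) $A_j\cap[a,a+1]\neq\emptyset$ for every $j\in\{1,\ldots,n-1\}$ and every $a\in\mathbb{R}$. Then there is a choice of elements $a_j\in A_j$ for $j=0,1,\ldots,n$ such that, with $z_j=a_j-a_{j-1}$ for $j\in\{1,\ldots,n\}$, $$|z_i-z_j|\le 1\quad\text{for all } i,j\in\{1,\ldots,n\}.$$
   Context: A choice $(a_0,a_1,\ldots,a_n)$ with $a_j\in A_j$ for every $j=0,\ldots,n$ is called a transversal of the system $A_0,\ldots,A_n$. *)

theory Defs
  imports Complex_Main
begin

end

theory Submission
  imports Defs "HOL-Analysis.Elementary_Normed_Spaces"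
begin

text \<open>
  Fix a real \<open>t\<close> and call a transversal \<open>t\<close>-tame if all its increments lie in \<open>{t..t + 1}\<close>; it
  suffices to find a tame transversal for some \<open>t\<close>.  Two relaxations separate the bounds: moving
  from \<open>0\<close> to \<open>s\<close> with all increments at least \<open>t\<close>, or with all increments at most \<open>t + 1\<close>.

  The first relaxation is decided by the greedy walk, which always takes the smallest admissible
  element of the next set.  It lies below every competitor, so it succeeds iff its last point
  before \<open>s\<close> is at most \<open>s - t\<close>.  By density its own increments never exceed \<open>t + 1\<close>.  So when it fails, because the
  last step to \<open>s\<close> is smaller than \<open>t\<close>, it is (continued to \<open>s\<close>) a solution of the second relaxation:
  for every \<open>t\<close> at least one of the two is solvable.  Reflecting all sets at the origin exchanges
  the relaxations.

  The greedy walk is monotone and lower semicontinuous as a function of \<open>t\<close>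
  (\<open>mono_lsc_greedy\<close>), so both relaxations are solvable for closed sets of parameters \<open>t\<close>.  These
  sets are nonempty and cover the line, which is connected; hence some \<open>t\<close> belongs to both.  For this
  \<open>t\<close> there is a lower walk \<open>b\<close> and an upper walk \<open>c\<close> with \<open>b \<le> c\<close>.  Going back from
  \<open>s\<close>, density always provides a predecessor between \<open>b\<close> and \<open>c\<close> with an increment in
  \<open>{t..t + 1}\<close> (\<open>interpolating_walk\<close>).
\<close>

section \<open>The next element of a relatively dense closed set\<close>

definition unit_dense :: "real set \<Rightarrow> bool" where
  "unit_dense B \<longleftrightarrow> closed B \<and> (\<forall>a. B \<inter> {a..a + 1} \<noteq> {})"

definition next_above :: "real set \<Rightarrow> real \<Rightarrow> real" where
  "next_above B x = Inf (B \<inter> {x..})"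

lemma next_above_least:
  assumes "y \<in> B" and "x \<le> y"
  shows "next_above B x \<le> y"
  unfolding next_above_def using assms by (intro cInf_lower) auto

lemma next_above_in:
  assumes "unit_dense B"
  shows "next_above B x \<in> B" and "x \<le> next_above B x"
proof -
  have "B \<inter> {x..} \<noteq> {}" and "closed (B \<inter> {x..})"
    using assms unfolding unit_dense_def by fastforce+
  then have "next_above B x \<in> B \<inter> {x..}"
    unfolding next_above_def by (intro closed_contains_Inf) auto
  then show "next_above B x \<in> B" and "x \<le> next_above B x"
    by auto
qed

lemma next_above_le:
  assumes "unit_dense B"
  shows "next_above B x \<le> x + 1"
proof -
  obtain y where "y \<in> B" and "x \<le> y" and "y \<le> x + 1"
    using assms unfolding unit_dense_def by fastforce
  then show ?thesis
    using next_above_least[of y B x] by linarith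
qed

text \<open>
  For a monotone function on the line, lower semicontinuity amounts to left continuity.  In this
  form it is inherited by compositions, which is what the recursive greedy walk requires.
\<close>

definition mono_lsc :: "(real \<Rightarrow> real) \<Rightarrow> bool" where
  "mono_lsc f \<longleftrightarrow> mono f \<and> (\<forall>x c. c < f x \<longrightarrow> (\<exists>d<x. c < f d))"

lemma mono_lsc_compose:
  assumes f: "mono_lsc f" and g: "mono_lsc g"
  shows "mono_lsc (\<lambda>x. f (g x))"
  unfolding mono_lsc_def
proof (intro conjI allI impI)
  show "mono (\<lambda>x. f (g x))"
    using assms unfolding mono_lsc_def mono_def by blast
next
  fix x c assume "c < f (g x)"
  then obtain d where "d < g x" and "c < f d"
    using f unfolding mono_lsc_def by blast
  moreover from \<open>d < g x\<close> obtain e where "e < x" and "d < g e"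
    using g unfolding mono_lsc_def by blast
  moreover have "f d \<le> f (g e)"
    using f \<open>d < g e\<close> unfolding mono_lsc_def mono_def by simp
  ultimately show "\<exists>d<x. c < f (g d)"
    by (intro exI[of _ e]) auto
qed

lemma mono_lsc_add_id:
  assumes f: "mono_lsc f"
  shows "mono_lsc (\<lambda>x. f x + x)"
  unfolding mono_lsc_def
proof (intro conjI allI impI)
  show "mono (\<lambda>x. f x + x)"
    using f unfolding mono_lsc_def mono_def by (simp add: add_mono)
next
  fix x c assume less: "c < f x + x"
  define e where "e = (f x + x - c) / 2"
  have "e > 0"
    using less by (simp add: e_def)
  then obtain d where d: "d < x" "f x - e < f d"
    using f unfolding mono_lsc_def by (metis diff_less_eq less_add_same_cancel1)
  define d' where "d' = max d (x - e)"
  have "d' < x" and "x - e \<le> d'" and "d \<le> d'"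
    using d \<open>e > 0\<close> by (auto simp: d'_def)
  moreover have "f d \<le> f d'"
    using f \<open>d \<le> d'\<close> unfolding mono_lsc_def mono_def by blast
  moreover have "c = (f x - e) + (x - e)"
    by (simp add: e_def)
  ultimately show "\<exists>d<x. c < f d + d"
    using d by (intro exI[of _ d']) linarith
qed

lemma closed_sublevel_mono_lsc:
  assumes f: "mono_lsc f"
  shows "closed {x. f x \<le> s}"
proof -
  have "\<exists>T. open T \<and> x \<in> T \<and> T \<subseteq> {x. s < f x}" if x: "s < f x" for x
  proof -
    obtain d where "d < x" and "s < f d"
      using f x unfolding mono_lsc_def by blast
    moreover have "f d \<le> f y" if "d < y" for y
      using f that unfolding mono_lsc_def mono_def by simp
    ultimately show ?thesis
      by (intro exI[of _ "{d<..}"]) (auto intro: less_le_trans)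
  qed
  then have "open {x. s < f x}"
    by (subst open_subopen) blast
  moreover have "- {x. f x \<le> s} = {x. s < f x}"
    by auto
  ultimately show ?thesis
    by (simp add: closed_def)
qed

text \<open>
  The next element jumps only immediately to the right of points of the set, which left continuity
  permits.  At a point \<open>x\<close> of the set its value is \<open>x\<close>, and to the left of \<open>x\<close> it is squeezed
  between the argument and \<open>x\<close>.  To the left of any other point it is locally constant.
\<close>

lemma mono_lsc_next_above:
  assumes B: "unit_dense B"
  shows "mono_lsc (next_above B)"
  unfolding mono_lsc_def
proof (intro conjI allI impI)
  show "mono (next_above B)"
  proof (rule monoI)
    fix x y :: real assume "x \<le> y"
    then show "next_above B x \<le> next_above B y"
      using next_above_in[OF B, of y] by (intro next_above_least) auto
  qed
next
  fix x c assume less: "c < next_above B x"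
  show "\<exists>d<x. c < next_above B d"
  proof (cases "x \<in> B")
    case True
    then have "c < x"
      using less next_above_least[of x B x] by simp
    then show ?thesis
      using next_above_in(2)[OF B, of "(c + x) / 2"] by (intro exI[of _ "(c + x) / 2"]) auto
  next
    case False
    moreover have "open (- B)"
      using B by (simp add: unit_dense_def open_Compl)
    ultimately obtain e where "e > 0" and e: "\<And>y. dist y x < e \<Longrightarrow> y \<notin> B"
      unfolding open_dist by auto
    \<comment> \<open>No element of \<open>B\<close> is within \<open>e\<close> of \<open>x\<close>, so the next element above \<open>x - e / 2\<close> is beyond \<open>x\<close>.\<close>
    define d where "d = x - e / 2"
    have "x \<le> next_above B d"
      using e[of "next_above B d"] next_above_in[OF B, of d] \<open>e > 0\<close>
      by (force simp: d_def dist_real_def)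
    then have "next_above B x \<le> next_above B d"
      using next_above_in[OF B, of d] by (intro next_above_least)
    then show ?thesis
      using less \<open>e > 0\<close> by (intro exI[of _ d]) (auto simp: d_def)
  qed
qed

section \<open>The greedy walk\<close>

primrec greedy :: "(nat \<Rightarrow> real set) \<Rightarrow> real \<Rightarrow> nat \<Rightarrow> real" where
  "greedy A t 0 = 0"
| "greedy A t (Suc j) = next_above (A (Suc j)) (greedy A t j + t)"

lemma greedy_step:
  assumes "unit_dense (A (Suc j))"
  shows "greedy A t (Suc j) \<in> A (Suc j)"
    and "greedy A t j + t \<le> greedy A t (Suc j)"
    and "greedy A t (Suc j) \<le> greedy A t j + t + 1"
  using next_above_in[OF assms] next_above_le[OF assms] by auto

lemma greedy_least:
  assumes "a 0 = 0"
    and "\<And>j. j < m \<Longrightarrow> a (Suc j) \<in> A (Suc j)"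
    and "\<And>j. j < m \<Longrightarrow> a j + t \<le> a (Suc j)"
  shows "j \<le> m \<Longrightarrow> greedy A t j \<le> a j"
proof (induction j)
  case (Suc j)
  then have "greedy A t j + t \<le> a (Suc j)"
    using assms(3)[of j] by simp
  then show ?case
    using assms(2)[of j] Suc.prems by (auto intro: next_above_least)
qed (simp add: assms)

lemma greedy_upper_bound:
  assumes "\<And>j. j \<in> {1..m} \<Longrightarrow> unit_dense (A j)"
  shows "j \<le> m \<Longrightarrow> greedy A t j \<le> real j * (t + 1)"
proof (induction j)
  case (Suc j)
  then show ?case
    using greedy_step(3)[of A j t] assms by (auto simp: algebra_simps)
qed simp

lemma mono_lsc_greedy:
  assumes "\<And>j. j \<in> {1..m} \<Longrightarrow> unit_dense (A j)"
  shows "j \<le> m \<Longrightarrow> mono_lsc (\<lambda>t. greedy A t j)"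
proof (induction j)
  case 0
  show ?case
    by (auto simp: mono_lsc_def mono_def intro: lt_ex)
next
  case (Suc j)
  then have "mono_lsc (\<lambda>t. greedy A t j + t)"
    by (intro mono_lsc_add_id) simp
  moreover have "mono_lsc (next_above (A (Suc j)))"
    using Suc.prems assms by (intro mono_lsc_next_above) simp
  ultimately show ?case
    using mono_lsc_compose by simp
qed

text \<open>
  The parameters for which the greedy walk leaves a last increment of at least \<open>t\<close> towards \<open>s\<close>.
  Each step is at most \<open>t + 1\<close>, so \<open>greedy A t m + t\<close> is at most \<open>m * (t + 1) + t\<close>, which
  equals \<open>s\<close> at \<open>t = (s - m) / (m + 1)\<close>.
\<close>

lemma feasible_parameters:
  assumes "\<And>j. j \<in> {1..m} \<Longrightarrow> unit_dense (A j)"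
  shows "closed {t. greedy A t m + t \<le> s}" and "{t. greedy A t m + t \<le> s} \<noteq> {}"
proof -
  show "closed {t. greedy A t m + t \<le> s}"
    using mono_lsc_greedy[OF assms, of m] by (intro closed_sublevel_mono_lsc mono_lsc_add_id) simp
  define t where "t = (s - real m) / (real m + 1)"
  have "greedy A t m \<le> real m * (t + 1)"
    using greedy_upper_bound[OF assms, where t = t and j = m] by simp
  moreover have "real m * (t + 1) + t = t * (real m + 1) + real m"
    by (simp add: algebra_simps)
  moreover have "t * (real m + 1) = s - real m"
    unfolding t_def by simp
  ultimately have "greedy A t m + t \<le> s"
    by simp
  then show "{t. greedy A t m + t \<le> s} \<noteq> {}"
    by blast
qed

section \<open>Balanced transversals\<close>

text \<open>
  The interval \<open>{x - t - 1..x - t}\<close> of possible predecessors of \<open>x\<close> meets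
  \<open>{b k..c k}\<close>.  Either it contains one of the end points \<open>b k\<close>, \<open>c k\<close>, or it lies between them
  and then density supplies a predecessor.
\<close>

lemma interpolating_walk:
  fixes b c :: "nat \<Rightarrow> real"
  assumes start: "b 0 = 0" "c 0 = 0"
    and dense: "\<And>j. j \<in> {1..m} \<Longrightarrow> unit_dense (A j)"
    and elem: "\<And>j. j \<in> {1..m} \<Longrightarrow> b j \<in> A j" "\<And>j. j \<in> {1..m} \<Longrightarrow> c j \<in> A j"
    and ord: "\<And>j. j \<le> m \<Longrightarrow> b j \<le> c j"
    and incr: "\<And>j. j < m \<Longrightarrow> b j + t \<le> b (Suc j)" "\<And>j. j < m \<Longrightarrow> c (Suc j) \<le> c j + t + 1"
  shows "k \<le> m \<Longrightarrow> b k + t \<le> x \<Longrightarrow> x \<le> c k + t + 1 \<Longrightarrow>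
    \<exists>a. a 0 = 0 \<and> (\<forall>j\<in>{1..k}. a j \<in> A j) \<and> (\<forall>j<k. a (Suc j) - a j \<in> {t..t + 1})
      \<and> x - a k \<in> {t..t + 1}"
proof (induction k arbitrary: x)
  case 0
  then show ?case
    using start by (intro exI[of _ "\<lambda>_. 0"]) auto
next
  case (Suc k)
  let ?k = "Suc k"
  have k: "?k \<in> {1..m}"
    using Suc.prems by simp
  obtain y where y: "y \<in> A ?k" "b ?k \<le> y" "y \<le> c ?k" "x - y \<in> {t..t + 1}"
  proof -
    consider "x - t - 1 \<le> b ?k" | "c ?k \<le> x - t" | "b ?k \<le> x - t - 1" "x - t \<le> c ?k"
      by linarith
    then show thesis
    proof cases
      case 1
      then show thesis
        using that[of "b ?k"] elem(1)[OF k] ord[of ?k] Suc.prems by auto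
    next
      case 2
      then show thesis
        using that[of "c ?k"] elem(2)[OF k] ord[of ?k] Suc.prems by auto
    next
      case 3
      have "A ?k \<inter> {x - t - 1..(x - t - 1) + 1} \<noteq> {}"
        using dense[OF k] unfolding unit_dense_def by blast
      then obtain y where "y \<in> A ?k" "x - t - 1 \<le> y" "y \<le> x - t"
        by auto
      then show thesis
        using that[of y] 3 by auto
    qed
  qed
  have "b k + t \<le> y" and "y \<le> c k + t + 1"
    using y incr(1)[of k] incr(2)[of k] Suc.prems by simp_all
  then obtain a where a: "a 0 = 0" "\<forall>j\<in>{1..k}. a j \<in> A j"
      "\<forall>j<k. a (Suc j) - a j \<in> {t..t + 1}" "y - a k \<in> {t..t + 1}"
    using Suc.IH[of y] Suc.prems by auto
  show ?case
    using a y by (intro exI[of _ "a(?k := y)"]) (auto simp: less_Suc_eq le_Suc_eq)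
qed

text \<open>
  Reflection at the origin turns the increment bound \<open>\<le> t + 1\<close> into \<open>\<ge> - t - 1\<close>, so the second
  relaxation is governed by the greedy walk of the reflected sets.
\<close>

lemma unit_dense_reflect:
  assumes "unit_dense B"
  shows "unit_dense (uminus ` B)"
  unfolding unit_dense_def
proof (intro conjI allI)
  show "closed (uminus ` B)"
    using assms by (simp add: unit_dense_def closed_negations)
next
  fix a :: real
  obtain y where "y \<in> B" "- a - 1 \<le> y" "y \<le> (- a - 1) + 1"
    using assms unfolding unit_dense_def by fastforce
  then have "- y \<in> uminus ` B \<inter> {a..a + 1}"
    by auto
  then show "uminus ` B \<inter> {a..a + 1} \<noteq> {}"
    by blast
qed

lemma balanced_walk_exists:
  fixes A :: "nat \<Rightarrow> real set" and s :: real
  assumes dense: "\<And>j. j \<in> {1..m} \<Longrightarrow> unit_dense (A j)"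
  obtains a t where "a 0 = 0" and "\<And>j. j \<in> {1..m} \<Longrightarrow> a j \<in> A j"
    and "\<And>j. j < m \<Longrightarrow> a (Suc j) - a j \<in> {t..t + 1}" and "s - a m \<in> {t..t + 1}"
proof -
  define R where "R j = uminus ` A j" for j
  have dense': "unit_dense (R j)" if "j \<in> {1..m}" for j
    unfolding R_def using dense[OF that] by (rule unit_dense_reflect)
  define P where "P = {t. greedy A t m + t \<le> s}"
  define Q where "Q = {t. greedy R (- t - 1) m + (- t - 1) \<le> - s}"
  have Q_eq: "Q = (\<lambda>t. - t - 1) -` {u. greedy R u m + u \<le> - s}"
    by (auto simp: Q_def)
  have P: "closed P" "P \<noteq> {}"
    unfolding P_def by (rule feasible_parameters; fact dense)+
  have Q: "closed Q"
    unfolding Q_eq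
  proof (rule closed_vimage)
    show "closed {u. greedy R u m + u \<le> - s}"
      by (rule feasible_parameters) (fact dense')
    show "continuous_on UNIV (\<lambda>t::real. - t - 1)"
      by (intro continuous_intros)
  qed
  have Q_nonempty: "Q \<noteq> {}"
  proof -
    have "{u. greedy R u m + u \<le> - s} \<noteq> {}"
      by (rule feasible_parameters) (fact dense')
    then obtain u where "greedy R u m + u \<le> - s"
      by blast
    then have "- u - 1 \<in> Q"
      by (simp add: Q_def)
    then show ?thesis
      by blast
  qed
  have cover: "t \<in> P \<union> Q" for t
  proof (cases "t \<in> P")
    case False
    \<comment> \<open>The greedy walk overshoots, so its reflection is feasible for the reflected problem.\<close>
    have "greedy R (- t - 1) m \<le> - greedy A t m"
    proof (rule greedy_least[where m = m and a = "\<lambda>j. - greedy A t j"])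
      fix j assume "j < m"
      then have "unit_dense (A (Suc j))"
        using dense by simp
      note step = greedy_step[of A, OF this, of t]
      show "- greedy A t (Suc j) \<in> R (Suc j)"
        unfolding R_def using step(1) by (rule imageI)
      show "- greedy A t j + (- t - 1) \<le> - greedy A t (Suc j)"
        using step(3) by linarith
    qed simp_all
    then show ?thesis
      using False by (auto simp: P_def Q_def)
  qed simp
  have "P \<inter> Q \<noteq> {}"
  proof
    assume "P \<inter> Q = {}"
    then have "P \<inter> UNIV = {} \<or> Q \<inter> UNIV = {}"
      using cover by (intro connected_closedD[OF connected_UNIV _ _ P(1) Q]) blast+
    then show False
      using P(2) Q_nonempty by simp
  qed
  then obtain t where "t \<in> P" and "t \<in> Q"
    by blast
  define h where "h j = - greedy R (- t - 1) j" for j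
  define b where "b = greedy A t"
  \<comment> \<open>Both walks have increments at most \<open>t + 1\<close>, and so has their maximum, which stays above \<open>b\<close>.\<close>
  define c where "c j = max (b j) (h j)" for j
  have b: "b (Suc j) \<in> A (Suc j)" "b j + t \<le> b (Suc j)" "b (Suc j) \<le> b j + t + 1"
    and h: "h (Suc j) \<in> A (Suc j)" "h (Suc j) \<le> h j + t + 1" if "j < m" for j
  proof -
    have "unit_dense (A (Suc j))" and "unit_dense (R (Suc j))"
      using that dense dense' by simp_all
    note A_step = greedy_step[of A, OF this(1), of t]
      and R_step = greedy_step[of R, OF this(2), of "- t - 1"]
    show "b (Suc j) \<in> A (Suc j)" "b j + t \<le> b (Suc j)" "b (Suc j) \<le> b j + t + 1"
      unfolding b_def by (rule A_step)+
    show "h (Suc j) \<in> A (Suc j)"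
      using R_step(1) unfolding h_def by (auto simp: R_def simp del: greedy.simps)
    show "h (Suc j) \<le> h j + t + 1"
      using R_step(2) unfolding h_def by linarith
  qed
  have "\<exists>a. a 0 = 0 \<and> (\<forall>j\<in>{1..m}. a j \<in> A j) \<and> (\<forall>j<m. a (Suc j) - a j \<in> {t..t + 1})
      \<and> s - a m \<in> {t..t + 1}"
  proof (rule interpolating_walk[where b = b and c = c])
    show "b 0 = 0" "c 0 = 0"
      by (simp_all add: b_def c_def h_def)
    show "b j \<in> A j" "c j \<in> A j" if "j \<in> {1..m}" for j
    proof -
      obtain i where i: "j = Suc i" "i < m"
        using \<open>j \<in> {1..m}\<close> by (cases j) auto
      show "b j \<in> A j" "c j \<in> A j"
        using b(1)[OF i(2)] h(1)[OF i(2)] i(1) by (auto simp: c_def max_def)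
    qed
    show "b j \<le> c j" for j
      by (simp add: c_def)
    show "b j + t \<le> b (Suc j)" "c (Suc j) \<le> c j + t + 1" if "j < m" for j
      using b(2,3)[OF that] h(2)[OF that] by (auto simp: c_def)
    show "b m + t \<le> s" "s \<le> c m + t + 1"
      using \<open>t \<in> P\<close> \<open>t \<in> Q\<close> by (auto simp: P_def Q_def b_def c_def h_def)
  qed (use dense in simp_all)
  then show thesis
    using that by blast
qed

theorem theorem1p2:
  fixes n :: nat and s :: real and A :: "nat \<Rightarrow> real set"
  assumes "n \<ge> 1"
    and "\<And>j. j \<in> {0..n} \<Longrightarrow> closed (A j)"
    and "A 0 = {0}" and "A n = {s}"
    and "\<And>j a. j \<in> {1..n-1} \<Longrightarrow> A j \<inter> {a..a+1} \<noteq> {}"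
  shows "\<exists>a z :: nat \<Rightarrow> real.
           (\<forall>j\<in>{0..n}. a j \<in> A j) \<and>
           (\<forall>j\<in>{1..n}. z j = a j - a (j - 1)) \<and>
           (\<forall>i\<in>{1..n}. \<forall>j\<in>{1..n}. \<bar>z i - z j\<bar> \<le> 1)"
proof -
  obtain m where n: "n = Suc m"
    using assms(1) by (cases n) auto
  have "unit_dense (A j)" if "j \<in> {1..m}" for j
    using that assms(2,5) n by (simp add: unit_dense_def)
  then obtain a t where a: "a 0 = 0" "\<And>j. j \<in> {1..m} \<Longrightarrow> a j \<in> A j"
      "\<And>j. j < m \<Longrightarrow> a (Suc j) - a j \<in> {t..t + 1}" "s - a m \<in> {t..t + 1}"
    using balanced_walk_exists[where A = A and m = m and s = s] by blast
  define w where "w = a(n := s)"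
  define z where "z j = w j - w (j - 1)" for j
  have "w j \<in> A j" if "j \<in> {0..n}" for j
    using that a(1,2) assms(3,4) n by (cases "j = 0") (auto simp: w_def le_Suc_eq)
  moreover have z: "t \<le> z j \<and> z j \<le> t + 1" if j: "j \<in> {1..n}" for j
  proof -
    obtain i where "j = Suc i" "i \<le> m"
      using j n by (cases j) auto
    then show ?thesis
      using a(3)[of i] a(4) n by (cases "i = m") (auto simp: z_def w_def)
  qed
  have "\<bar>z i - z j\<bar> \<le> 1" if "i \<in> {1..n}" "j \<in> {1..n}" for i j
    using z[OF that(1)] z[OF that(2)] by linarith
  ultimately show ?thesis
    by (intro exI[of _ w] exI[of _ z]) (auto simp: z_def)
qed

end
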